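(* Let $\nu\in(0,\infty)$ and suppose that $f=h+\overline{g}\in\mathcal{B}^*_H(\nu)$ is sense-preserving in $\mathbb{D}$ with the dilatation $\omega_f$, where $h(z)=\sum_{n=0}^\infty a_nz^n$ and $g(z)=\sum_{n=1}^\infty b_nz^n$. Then $$\max\{|h(z)-a_0|,|g(z)|\}\leq\beta^*_\nu(f)\sqrt{\frac{1+|\omega_f(0)|}{1-|\omega_f(0)|}}\,h_\nu(r),\qquad |z|=r<1.$$ The estimate is sharp in order of magnitude for each $\nu>1/2$. If $\nu<1/2$, then each of $h$, $g$, $f$ is bounded in $\mathbb{D}$.
   Context: $\mathbb{D}=\{z:|z|<1\}$ is the open unit disk in $\mathbb{C}$. A harmonic mapping in $\mathbb{D}$ is a complex-valued function $f$ with $f_{z\overline{z}}=0$; its canonical decomposition is $f=h+\overline{g}$ with $h,g$ analytic in $\mathbb{D}$ and $g(0)=0$. Its Jacobian is $J_f=|f_z|^2-|f_{\overline{z}}|^2=|h'|^2-|g'|^2$. The mapping $f$ is (locally univalent and) sense-preserving in $\mathbb{D}$ if and only if $J_f>0$ in $\mathbb{D}$, i.e. $|h'|>|g'|$ in $\mathbb{D}$; its dilatation is $\omega_f=g'/h'$. For $\nu\in(0,\infty)$, $\beta^*_\nu(f)=\sup_{z\in\mathbb{D}}(1-|z|^2)^\nu\sqrt{|J_f(z)|}$, and $\mathcal{B}^*_H(\nu)$ is the set of all harmonic mappings $f$ in $\mathbb{D}$ with $\beta^*_\nu(f)<\infty$ (harmonic $\nu$-Bloch-type mappings). The function $h_\nu$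 (not to be confused with the analytic part $h$ of $f$) is defined by $h_\nu(z)=-\log(1-z)$ for $\nu=1/2$, and $h_\nu(z)=(\nu-1/2)^{-1}\left[(1-z)^{1/2-\nu}-1\right]$ for $\nu\neq1/2$. *)

theory Defs
  imports "HOL-Complex_Analysis.Complex_Analysis" "HOL-Library.Landau_Symbols"
begin

text \<open>The Wirtinger derivatives \<open>f\<^sub>z = (f\<^sub>x - i f\<^sub>y) / 2\<close> and
  \<open>f\<^sub>z\<^sub>b\<^sub>a\<^sub>r = (f\<^sub>x + i f\<^sub>y) / 2\<close>: the real partial derivatives \<open>f\<^sub>x\<close>, \<open>f\<^sub>y\<close> are the values
  of the real Frechet derivative at 1 and at i.  They are meaningful only where \<open>f\<close> is
  real-differentiable.\<close>

definition wirtinger_z :: "(complex \<Rightarrow> complex) \<Rightarrow> complex \<Rightarrow> complex" where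
  "wirtinger_z f z =
     (frechet_derivative f (at z) 1 - \<i> * frechet_derivative f (at z) \<i>) / 2"

definition wirtinger_zbar :: "(complex \<Rightarrow> complex) \<Rightarrow> complex \<Rightarrow> complex" where
  "wirtinger_zbar f z =
     (frechet_derivative f (at z) 1 + \<i> * frechet_derivative f (at z) \<i>) / 2"

definition C1_on_disk :: "(complex \<Rightarrow> complex) \<Rightarrow> bool" where
  "C1_on_disk f \<longleftrightarrow>
     (\<forall>z\<in>ball 0 1. f differentiable at z) \<and>
     continuous_on (ball 0 1) (wirtinger_z f) \<and>
     continuous_on (ball 0 1) (wirtinger_zbar f)"

text \<open>The equation \<open>f\<^sub>z\<^sub>z\<^sub>b\<^sub>a\<^sub>r = 0\<close> is imposed on twice continuously (real-)differentiable
  functions.  Values outside the disk are irrelevant.\<close>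

definition harmonic_mapping :: "(complex \<Rightarrow> complex) \<Rightarrow> bool" where
  "harmonic_mapping f \<longleftrightarrow>
     C1_on_disk f \<and> C1_on_disk (wirtinger_z f) \<and> C1_on_disk (wirtinger_zbar f) \<and>
     (\<forall>z\<in>ball 0 1. wirtinger_zbar (wirtinger_z f) z = 0)"

definition canonical_decomposition ::
    "(complex \<Rightarrow> complex) \<Rightarrow> (complex \<Rightarrow> complex) \<Rightarrow> (complex \<Rightarrow> complex) \<Rightarrow> bool" where
  "canonical_decomposition f h g \<longleftrightarrow>
     h analytic_on ball 0 1 \<and> g analytic_on ball 0 1 \<and> g 0 = 0 \<and>
     (\<forall>z\<in>ball 0 1. f z = h z + cnj (g z))"

definition wirtinger_jacobian :: "(complex \<Rightarrow> complex) \<Rightarrow> complex \<Rightarrow> real" where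
  "wirtinger_jacobian f z = (cmod (wirtinger_z f z))\<^sup>2 - (cmod (wirtinger_zbar f z))\<^sup>2"

text \<open>Sense-preserving is understood to include local univalence; for harmonic mappings this
  means a positive Jacobian.\<close>

definition sense_preserving :: "(complex \<Rightarrow> complex) \<Rightarrow> bool" where
  "sense_preserving f \<longleftrightarrow> (\<forall>z\<in>ball 0 1. wirtinger_jacobian f z > 0)"

text \<open>The dilatation of \<open>f = h + cnj g\<close>, expressed through the canonical decomposition
  (which is determined by \<open>f\<close> on the disk).\<close>

definition dilatation :: "(complex \<Rightarrow> complex) \<Rightarrow> (complex \<Rightarrow> complex) \<Rightarrow> complex \<Rightarrow> complex" where
  "dilatation h g z = deriv g z / deriv h z"

definition bloch_weight :: "real \<Rightarrow> (complex \<Rightarrow> complex) \<Rightarrow> complex \<Rightarrow> real" where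
  "bloch_weight \<nu> f z = (1 - (cmod z)\<^sup>2) powr \<nu> * sqrt \<bar>wirtinger_jacobian f z\<bar>"

text \<open>The real-valued supremum is meaningful only when the weighted quantity is bounded on
  the disk; the class below requires this (it is the condition \<open>\<beta>\<^sup>*\<^sub>\<nu>(f) < \<infinity>\<close>).\<close>

definition bloch_beta :: "real \<Rightarrow> (complex \<Rightarrow> complex) \<Rightarrow> real" where
  "bloch_beta \<nu> f = (SUP z\<in>ball 0 1. bloch_weight \<nu> f z)"

definition harmonic_bloch_type :: "real \<Rightarrow> (complex \<Rightarrow> complex) set" where
  "harmonic_bloch_type \<nu> =
     {f. harmonic_mapping f \<and> bdd_above (bloch_weight \<nu> f ` ball 0 1)}"

text \<open>One definition for both the real and the complex argument; in the complex case \<open>ln\<close> and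
  \<open>powr\<close> are the principal branches, and \<open>1 - z\<close> has positive real part on the disk.\<close>

definition h_nu :: "real \<Rightarrow> 'a::{ln,real_normed_field} \<Rightarrow> 'a" where
  "h_nu \<nu> z =
     (if \<nu> = 1/2 then - ln (1 - z)
      else of_real (inverse (\<nu> - 1/2)) * ((1 - z) powr of_real (1/2 - \<nu>) - 1))"

end

theory Submission
  imports Defs
begin

text \<open>
  Write \<open>c = |\<omega>(0)|\<close>.  The Schwarz-Pick inequality for \<open>\<omega> = g'/h'\<close> gives
  \<open>1 - |\<omega>(z)|\<^sup>2 \<ge> (1 - c)/(1 + c) (1 - |z|\<^sup>2)\<close>.  Since \<open>J = |h'|\<^sup>2 (1 - |\<omega>|\<^sup>2)\<close>, the Bloch condition
  turns into \<open>|g'| \<le> |h'| \<le> \<beta> sqrt ((1 + c)/(1 - c)) (1 - |z|) powr (-\<nu> - 1/2)\<close>, and integrating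
  along a radius produces \<open>h\<^sub>\<nu>\<close>.  For sharpness take \<open>h = h\<^sub>\<nu>\<close> and \<open>\<omega>(z) = z\<close>: then the weighted
  root of the Jacobian is the \<open>(\<nu> + 1/2)\<close>-th power of \<open>(1 - |z|\<^sup>2)/|1 - z| \<le> 2\<close>.
\<close>

section \<open>The Schwarz-Pick estimate\<close>

lemma disk_automorphism_identity:
  fixes w u :: complex
  shows "(cmod (1 - cnj w * u))\<^sup>2 - (cmod (u - w))\<^sup>2 = (1 - (cmod w)\<^sup>2) * (1 - (cmod u)\<^sup>2)"
proof -
  \<comment> \<open>Over the complex numbers a squared modulus is x times its conjugate, so the
    claim becomes a polynomial identity.\<close>
  have "complex_of_real ((cmod (1 - cnj w * u))\<^sup>2 - (cmod (u - w))\<^sup>2) =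
        of_real ((1 - (cmod w)\<^sup>2) * (1 - (cmod u)\<^sup>2))"
    by (simp only: of_real_diff of_real_mult of_real_1 complex_norm_square)
       (simp add: algebra_simps)
  then show ?thesis by (simp only: of_real_eq_iff)
qed

text \<open>Following \<open>\<omega>\<close> by the disk automorphism that moves
  \<open>\<omega> 0\<close> to 0 gives a self-map \<open>\<phi>\<close> of the disk fixing 0, so the
  Schwarz lemma bounds it by |z|. Squaring this and inserting the automorphism identity turns it
  into a lower bound for 1 - |\<open>\<omega> z\<close>|^2.\<close>

lemma Schwarz_Pick_lower_bound:
  assumes hol: "\<omega> holomorphic_on ball 0 1"
    and lt: "\<And>z. cmod z < 1 \<Longrightarrow> cmod (\<omega> z) < 1"
    and z: "cmod z < 1"
  shows "(1 - cmod (\<omega> 0)) / (1 + cmod (\<omega> 0)) * (1 - (cmod z)\<^sup>2) \<le> 1 - (cmod (\<omega> z))\<^sup>2"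
proof -
  define w where "w = \<omega> 0"
  define c where "c = cmod w"
  define \<phi> where "\<phi> = (\<lambda>z. (\<omega> z - w) / (1 - cnj w * \<omega> z))"
  have c: "0 \<le> c" "c < 1" using lt[of 0] by (auto simp: c_def w_def)
  have den: "1 - c \<le> cmod (1 - cnj w * \<omega> u)" if "cmod u < 1" for u
  proof -
    have "cmod (cnj w * \<omega> u) \<le> c * 1"
      unfolding norm_mult c_def complex_mod_cnj using lt[OF that] by (intro mult_left_mono) auto
    then show ?thesis using norm_triangle_ineq2[of 1 "cnj w * \<omega> u"] by simp
  qed
  have nz: "1 - cnj w * \<omega> u \<noteq> 0" if "cmod u < 1" for u
    using den[OF that] c by auto
  have "\<phi> holomorphic_on ball 0 1"
    unfolding \<phi>_def by (intro holomorphic_intros hol) (use nz in auto)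
  moreover have "\<phi> 0 = 0" by (simp add: \<phi>_def w_def)
  moreover have "cmod (\<phi> u) < 1" if u: "cmod u < 1" for u
  proof -
    have "0 < (1 - (cmod w)\<^sup>2) * (1 - (cmod (\<omega> u))\<^sup>2)"
      using lt[OF u] c by (intro mult_pos_pos) (auto simp: c_def abs_square_less_1)
    then have "(cmod (\<omega> u - w))\<^sup>2 < (cmod (1 - cnj w * \<omega> u))\<^sup>2"
      using disk_automorphism_identity[of w "\<omega> u"] by linarith
    then have "cmod (\<omega> u - w) < cmod (1 - cnj w * \<omega> u)"
      by (simp add: power2_less_imp_less)
    then show ?thesis using nz[OF u] by (simp add: \<phi>_def norm_divide divide_less_eq)
  qed
  ultimately have "cmod (\<phi> z) \<le> cmod z" using Schwarz_Lemma(1)[of \<phi> z] z by blast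
  then have "cmod (\<omega> z - w) \<le> cmod z * cmod (1 - cnj w * \<omega> z)"
    using nz[OF z] by (simp add: \<phi>_def norm_divide divide_le_eq)
  then have "(cmod (\<omega> z - w))\<^sup>2 \<le> (cmod z)\<^sup>2 * (cmod (1 - cnj w * \<omega> z))\<^sup>2"
    by (metis norm_ge_zero power_mono power_mult_distrib)
  then have *: "(1 - (cmod z)\<^sup>2) * (cmod (1 - cnj w * \<omega> z))\<^sup>2 \<le> (1 - c\<^sup>2) * (1 - (cmod (\<omega> z))\<^sup>2)"
    using disk_automorphism_identity[of w "\<omega> z"] by (simp add: c_def algebra_simps)
  \<comment> \<open>Replacing the denominator by its lower bound 1 - c leaves (1 - c)^2 on the left.
    One factor cancels against 1 - c^2 = (1 - c)(1 + c), which leaves the quotient (1 - c)/(1 +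
    c).\<close>
  have "(1 - (cmod z)\<^sup>2) * (1 - c)\<^sup>2 \<le> (1 - (cmod z)\<^sup>2) * (cmod (1 - cnj w * \<omega> z))\<^sup>2"
    using den[OF z] c z by (intro mult_left_mono power_mono) (auto simp: abs_square_le_1)
  also note *
  also have "(1 - c\<^sup>2) * (1 - (cmod (\<omega> z))\<^sup>2) = (1 - c) * ((1 + c) * (1 - (cmod (\<omega> z))\<^sup>2))"
    by (simp add: power2_eq_square algebra_simps)
  finally have "(1 - c) * ((1 - c) * (1 - (cmod z)\<^sup>2)) \<le> (1 - c) * ((1 + c) * (1 - (cmod (\<omega> z))\<^sup>2))"
    by (simp add: power2_eq_square algebra_simps)
  then have "(1 - c) * (1 - (cmod z)\<^sup>2) \<le> (1 + c) * (1 - (cmod (\<omega> z))\<^sup>2)"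
    using c by (simp add: mult_le_cancel_left)
  then show ?thesis using c by (simp add: divide_simps mult.commute flip: c_def w_def)
qed

section \<open>Wirtinger calculus for sums of a holomorphic and an antiholomorphic function\<close>

lemma has_derivative_holomorphic_plus_cnj:
  assumes "open S" "h holomorphic_on S" "g holomorphic_on S"
    and eq: "\<And>z. z \<in> S \<Longrightarrow> f z = h z + cnj (g z)" and z: "z \<in> S"
  shows "(f has_derivative (\<lambda>v. deriv h z * v + cnj (deriv g z * v))) (at z)"
proof -
  have "(h has_derivative (\<lambda>v. deriv h z * v)) (at z)" "(g has_derivative (\<lambda>v. deriv g z * v)) (at z)"
    using holomorphic_derivI[OF assms(2,1) z] holomorphic_derivI[OF assms(3,1) z]
    by (auto simp: has_field_derivative_def)
  then have "((\<lambda>z. h z + cnj (g z)) has_derivative (\<lambda>v. deriv h z * v + cnj (deriv g z * v))) (at z)"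
    by (intro has_derivative_add has_derivative_cnj)
  then show ?thesis
    by (rule has_derivative_transform_within_open[OF _ assms(1) z]) (simp add: eq)
qed

text \<open>The values of the real derivative at 1 and i are h' + cnj g' and i (h' - cnj g'); the
  two Wirtinger combinations separate its complex linear part from its antilinear part.\<close>

lemma wirtinger_holomorphic_plus_cnj:
  assumes "open S" "h holomorphic_on S" "g holomorphic_on S"
    and "\<And>z. z \<in> S \<Longrightarrow> f z = h z + cnj (g z)" and "z \<in> S"
  shows "wirtinger_z f z = deriv h z" and "wirtinger_zbar f z = cnj (deriv g z)"
proof -
  note eq = frechet_derivative_at[OF has_derivative_holomorphic_plus_cnj[OF assms], symmetric]
  show "wirtinger_z f z = deriv h z" "wirtinger_zbar f z = cnj (deriv g z)"
    by (simp_all add: wirtinger_z_def wirtinger_zbar_def eq algebra_simps)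
qed

lemma C1_on_disk_holomorphic_plus_cnj:
  assumes h: "h holomorphic_on ball 0 1" and g: "g holomorphic_on ball 0 1"
    and eq: "\<And>z. z \<in> ball 0 1 \<Longrightarrow> f z = h z + cnj (g z)"
  shows "C1_on_disk f"
  unfolding C1_on_disk_def
proof (intro conjI ballI)
  fix z :: complex assume "z \<in> ball 0 1"
  then show "f differentiable at z"
    using has_derivative_holomorphic_plus_cnj[OF open_ball h g eq] differentiableI by blast
next
  have "continuous_on (ball 0 1) (deriv h)" "continuous_on (ball 0 1) (deriv g)"
    using h g by (auto intro: holomorphic_on_imp_continuous_on holomorphic_deriv)
  then have "continuous_on (ball 0 1) (deriv h)" "continuous_on (ball 0 1) (\<lambda>z. cnj (deriv g z))"
    by (auto intro: continuous_on_cnj)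
  then show "continuous_on (ball 0 1) (wirtinger_z f)" "continuous_on (ball 0 1) (wirtinger_zbar f)"
    using wirtinger_holomorphic_plus_cnj[OF open_ball h g eq]
    by (metis (no_types, lifting) continuous_on_cong)+
qed

text \<open>Serves to place the sharpness example in the Bloch-type class. On the disk the two
  Wirtinger derivatives are h' + cnj 0 and 0 + cnj g', so the preceding lemmas apply to them again
  with one part zero.\<close>

lemma harmonic_mapping_holomorphic_plus_cnj:
  assumes h: "h holomorphic_on ball 0 1" and g: "g holomorphic_on ball 0 1"
    and eq: "\<And>z. z \<in> ball 0 1 \<Longrightarrow> f z = h z + cnj (g z)"
  shows "harmonic_mapping f"
proof -
  note w = wirtinger_holomorphic_plus_cnj[OF open_ball h g eq]
  have h': "deriv h holomorphic_on ball 0 1" and g': "deriv g holomorphic_on ball 0 1"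
    using h g by (auto intro: holomorphic_deriv)
  have 0: "(\<lambda>z. 0) holomorphic_on ball (0::complex) 1" by simp
  have "wirtinger_zbar (wirtinger_z f) z = 0" if "z \<in> ball 0 1" for z
    using wirtinger_holomorphic_plus_cnj(2)[OF open_ball h' 0, of "wirtinger_z f" z] w(1) that by simp
  then show ?thesis
    unfolding harmonic_mapping_def
    using C1_on_disk_holomorphic_plus_cnj[OF h g eq]
      C1_on_disk_holomorphic_plus_cnj[OF h' 0, of "wirtinger_z f"]
      C1_on_disk_holomorphic_plus_cnj[OF 0 g', of "wirtinger_zbar f"] w
    by auto
qed

section \<open>The comparison function \<open>h_nu\<close>\<close>

lemma h_nu_0 [simp]:
  "h_nu \<nu> (0::real) = 0" "h_nu \<nu> (0::complex) = 0"
  by (simp_all add: h_nu_def)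

text \<open>This explains the two cases in the definition: both are the primitive, vanishing at 0,
  of one and the same power of 1 - t.\<close>

lemma has_real_derivative_h_nu:
  assumes "t < (1::real)"
  shows "(h_nu \<nu> has_real_derivative (1 - t) powr (- \<nu> - 1/2)) (at t)"
proof (cases "\<nu> = 1/2")
  case True
  have "- \<nu> - 1/2 = - 1" using True by simp
  then have "((\<lambda>t. - ln (1 - t)) has_real_derivative (1 - t) powr (- \<nu> - 1/2)) (at t)"
    using assms by (auto intro!: derivative_eq_intros simp: powr_minus field_simps)
  moreover have "h_nu \<nu> = (\<lambda>t::real. - ln (1 - t))" using True by (simp add: h_nu_def fun_eq_iff)
  ultimately show ?thesis by simp
next
  case False
  have "((\<lambda>t. inverse (\<nu> - 1/2) * ((1 - t) powr (1/2 - \<nu>) - 1)) has_real_derivative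
          inverse (\<nu> - 1/2) * ((1/2 - \<nu>) * (1 - t) powr (1/2 - \<nu> - 1) * (- 1))) (at t)"
    using assms by (auto intro!: derivative_eq_intros)
  moreover have "inverse (\<nu> - 1/2) * ((1/2 - \<nu>) * x * (- 1)) = x" for x
    using False by (simp add: field_simps)
  moreover have "1/2 - \<nu> - 1 = - \<nu> - 1/2" by simp
  moreover have "h_nu \<nu> = (\<lambda>t::real. inverse (\<nu> - 1/2) * ((1 - t) powr (1/2 - \<nu>) - 1))"
    using False by (simp add: h_nu_def fun_eq_iff)
  ultimately show ?thesis by (simp only:)
qed

lemma has_field_derivative_h_nu:
  assumes "cmod z < 1"
  shows "(h_nu \<nu> has_field_derivative (1 - z) powr of_real (- \<nu> - 1/2)) (at z)"
proof -
  have "Re z < 1" using assms complex_Re_le_cmod[of z] by linarith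
  \<comment> \<open>The point 1 - z lies in the right half-plane, hence off the branch cut of
    \<open>ln\<close> and \<open>powr\<close>.\<close>
  then have n: "1 - z \<notin> \<real>\<^sub>\<le>\<^sub>0" "1 - z \<noteq> 0" by (auto simp: complex_nonpos_Reals_iff)
  show ?thesis
  proof (cases "\<nu> = 1/2")
    case True
    have "- \<nu> - 1/2 = - 1" using True by simp
    moreover have "((\<lambda>t. - ln (1 - t)) has_field_derivative (1 - z) powr (- 1)) (at z)"
      using n by (auto intro!: derivative_eq_intros simp: powr_minus field_simps)
    ultimately have "((\<lambda>t. - ln (1 - t)) has_field_derivative (1 - z) powr of_real (- \<nu> - 1/2)) (at z)"
      by simp
    moreover have "h_nu \<nu> = (\<lambda>t::complex. - ln (1 - t))" using True by (simp add: h_nu_def fun_eq_iff)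
    ultimately show ?thesis by simp
  next
    case False
    \<comment> \<open>In terms of the exponent d the leading constant is -1/d, which cancels the
      factors d and -1 produced by differentiation.\<close>
    define d where "d = complex_of_real (1/2 - \<nu>)"
    have d: "d \<noteq> 0" "complex_of_real (inverse (\<nu> - 1/2)) = - inverse d"
      using False by (auto simp: d_def field_simps simp flip: of_real_diff of_real_inverse of_real_minus)
    have "((\<lambda>t. - inverse d * ((1 - t) powr d - 1)) has_field_derivative
            - inverse d * (d * (1 - z) powr (d - 1) * (- 1))) (at z)"
      using n by (auto intro!: derivative_eq_intros)
    moreover have "- inverse d * (d * (1 - z) powr (d - 1) * (- 1)) = (1 - z) powr (d - 1)"
      using d by simp
    moreover have "d - 1 = of_real (- \<nu> - 1/2)" by (simp add: d_def)
    moreover have "h_nu \<nu> = (\<lambda>t::complex. - inverse d * ((1 - t) powr d - 1))"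
      using False d(2) by (simp only: h_nu_def fun_eq_iff if_False simp_thms flip: d_def)
    ultimately show ?thesis by (simp only:)
  qed
qed

text \<open>Links the complex \<open>h_nu\<close> of the extremal example to the real
  \<open>h_nu\<close> of the bound.\<close>

lemma h_nu_of_real:
  assumes "r < 1"
  shows "h_nu \<nu> (complex_of_real r) = of_real (h_nu \<nu> r)"
proof -
  have "1 - complex_of_real r = of_real (1 - r)" by simp
  then show ?thesis
    using assms by (simp only: h_nu_def Ln_of_real powr_of_real) simp
qed

lemma h_nu_nonneg:
  assumes "0 \<le> r" "r < (1::real)"
  shows "0 \<le> h_nu \<nu> r"
proof -
  have "h_nu \<nu> 0 \<le> h_nu \<nu> r"
  proof (rule DERIV_nonneg_imp_nondecreasing[OF assms(1)])
    fix t :: real assume "0 \<le> t" "t \<le> r"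
    then show "\<exists>y. (h_nu \<nu> has_real_derivative y) (at t) \<and> 0 \<le> y"
      using has_real_derivative_h_nu[of t \<nu>] assms(2) powr_ge_zero by fastforce
  qed
  then show ?thesis by simp
qed

text \<open>Real \<open>powr\<close> is nonnegative for every base, so the subtracted power can only
  lower the value of the bracket below 1.\<close>

lemma h_nu_le:
  assumes "\<nu> < 1/2"
  shows "h_nu \<nu> r \<le> inverse (1/2 - \<nu>)"
proof -
  have "h_nu \<nu> r = inverse (1/2 - \<nu>) * (1 - (1 - r) powr (1/2 - \<nu>))"
    using assms by (simp add: h_nu_def field_simps)
  also have "\<dots> \<le> inverse (1/2 - \<nu>) * 1"
    using assms by (intro mult_left_mono) auto
  finally show ?thesis by simp
qed

section \<open>Growth estimates by radial integration\<close>

text \<open>Along the ray through z the curve t to F(t u) has speed at most the derivative of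
  \<open>K * h_nu \<nu> t\<close>. The mean value inequality with a real majorant compares the
  increments; the origin is split off because it has no direction.\<close>

lemma radial_growth_h_nu:
  assumes F: "F holomorphic_on ball 0 1"
    and bound: "\<And>z. cmod z < 1 \<Longrightarrow> cmod (deriv F z) \<le> K * (1 - cmod z) powr (- \<nu> - 1/2)"
    and z: "cmod z < 1"
  shows "cmod (F z - F 0) \<le> K * h_nu \<nu> (cmod z)"
proof (cases "z = 0")
  case False
  define r u where "r = cmod z" and "u = sgn z"
  have r: "0 < r" "r < 1" and u: "cmod u = 1" and zu: "z = of_real r * u"
    using False z by (auto simp: r_def u_def norm_divide sgn_eq)
  have in_disk: "cmod (of_real t * u) < 1" if "0 \<le> t" "t \<le> r" for t
    using that r u by (simp add: norm_mult)
  have der: "((\<lambda>t. F (of_real t * u)) has_vector_derivative u * deriv F (of_real t * u)) (at t)"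
    if "0 \<le> t" "t \<le> r" for t
  proof -
    have "((\<lambda>t. complex_of_real t * u) has_vector_derivative u) (at t)"
      by (auto intro!: derivative_eq_intros)
    moreover have "(F has_field_derivative deriv F (of_real t * u)) (at (of_real t * u))"
      using holomorphic_derivI[OF F open_ball] in_disk[OF that] by simp
    ultimately show ?thesis using field_vector_diff_chain_at by (fastforce simp: o_def)
  qed
  have der': "((\<lambda>t. K * h_nu \<nu> t) has_vector_derivative K * (1 - t) powr (- \<nu> - 1/2)) (at t)"
    if "t \<le> r" for t
    using has_real_derivative_h_nu[of t \<nu>] that r
    by (intro DERIV_cmult has_real_derivative_iff_has_vector_derivative[THEN iffD1]) auto
  have "cmod (F (of_real r * u) - F (of_real 0 * u)) \<le> K * h_nu \<nu> r - K * h_nu \<nu> 0"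
  proof (rule differentiable_bound_general[OF r(1)])
    show "continuous_on {0..r} (\<lambda>t. F (of_real t * u))"
      using der by (intro continuous_at_imp_continuous_on ballI has_vector_derivative_continuous) auto
    show "continuous_on {0..r} (\<lambda>t. K * h_nu \<nu> t)"
      using der' by (intro continuous_at_imp_continuous_on ballI has_vector_derivative_continuous) auto
    fix t assume t: "0 < t" "t < r"
    show "((\<lambda>t. F (of_real t * u)) has_vector_derivative u * deriv F (of_real t * u)) (at t)"
      using der t by auto
    show "((\<lambda>t. K * h_nu \<nu> t) has_vector_derivative K * (1 - t) powr (- \<nu> - 1/2)) (at t)"
      using der' t by auto
    show "cmod (u * deriv F (of_real t * u)) \<le> K * (1 - t) powr (- \<nu> - 1/2)"
      using bound[OF in_disk[of t]] t u by (simp add: norm_mult)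
  qed
  then show ?thesis by (simp flip: zu r_def)
qed simp

lemma growth_bound:
  fixes \<nu> :: real
  assumes nu: "\<nu> > 0"
    and f: "f \<in> harmonic_bloch_type \<nu>" and dec: "canonical_decomposition f h g"
    and sp: "sense_preserving f" and z: "cmod z < 1"
  shows "max (cmod (h z - h 0)) (cmod (g z))
           \<le> bloch_beta \<nu> f * sqrt ((1 + cmod (dilatation h g 0)) / (1 - cmod (dilatation h g 0)))
              * h_nu \<nu> (cmod z)"
proof -
  define \<omega> where "\<omega> = dilatation h g"
  define c where "c = cmod (\<omega> 0)"
  define K where "K = bloch_beta \<nu> f * sqrt ((1 + c) / (1 - c))"
  have h: "h holomorphic_on ball 0 1" and g: "g holomorphic_on ball 0 1" and "g 0 = 0"
    and eq: "\<And>z. z \<in> ball 0 1 \<Longrightarrow> f z = h z + cnj (g z)"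
    using dec analytic_imp_holomorphic unfolding canonical_decomposition_def by auto
  have J: "wirtinger_jacobian f u = (cmod (deriv h u))\<^sup>2 - (cmod (deriv g u))\<^sup>2"
    if "cmod u < 1" for u
    using wirtinger_holomorphic_plus_cnj[OF open_ball h g eq, of u] that
    by (simp add: wirtinger_jacobian_def)
  have gh: "cmod (deriv g u) < cmod (deriv h u)" if "cmod u < 1" for u
  proof (rule power2_less_imp_less)
    have "0 < wirtinger_jacobian f u" using sp that by (simp add: sense_preserving_def)
    then show "(cmod (deriv g u))\<^sup>2 < (cmod (deriv h u))\<^sup>2" using J[OF that] by linarith
  qed simp
  have h0: "deriv h u \<noteq> 0" if "cmod u < 1" for u using gh[OF that] by auto
  have \<omega>: "\<omega> holomorphic_on ball 0 1"
    unfolding \<omega>_def dilatation_def[abs_def] using h g h0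
    by (intro holomorphic_intros holomorphic_deriv) auto
  have \<omega>1: "cmod (\<omega> u) < 1" if "cmod u < 1" for u
    using gh[OF that] h0[OF that] by (simp add: \<omega>_def dilatation_def norm_divide)
  have c: "0 \<le> c" "c < 1" using \<omega>1[of 0] by (auto simp: c_def)
  have bdd: "bdd_above (bloch_weight \<nu> f ` ball 0 1)"
    using f by (simp add: harmonic_bloch_type_def)
  have h': "cmod (deriv h u) \<le> K * (1 - cmod u) powr (- \<nu> - 1/2)" if u: "cmod u < 1" for u
  proof -
    define s where "s = 1 - (cmod u)\<^sup>2"
    \<comment> \<open>The square root of the Schwarz-Pick constant; its inverse is the factor that
      appears in K.\<close>
    define q where "q = sqrt ((1 - c) / (1 + c))"
    have s: "0 < s" using u by (simp add: s_def abs_square_less_1)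
    have us: "1 - cmod u \<le> s"
      using u mult_left_le[of "cmod u" "cmod u"] by (simp add: s_def power2_eq_square)
    have q: "0 < q" "inverse q = sqrt ((1 + c) / (1 - c))"
      using c by (auto simp: q_def simp flip: real_sqrt_inverse)
    have "(cmod (deriv h u))\<^sup>2 * ((1 - c) / (1 + c) * s) \<le> (cmod (deriv h u))\<^sup>2 * (1 - (cmod (\<omega> u))\<^sup>2)"
      unfolding c_def s_def
      by (intro mult_left_mono Schwarz_Pick_lower_bound[OF \<omega> \<omega>1 u]) auto
    also have "\<dots> = wirtinger_jacobian f u"
      using h0[OF u] by (simp add: J[OF u] \<omega>_def dilatation_def norm_divide field_simps)
    finally have "sqrt ((cmod (deriv h u))\<^sup>2 * ((1 - c) / (1 + c) * s)) \<le> sqrt \<bar>wirtinger_jacobian f u\<bar>"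
      by (intro real_sqrt_le_mono) linarith
    \<comment> \<open>The factor s under the root contributes an extra power 1/2, which raises the
      exponent of the weight from \<open>\<nu>\<close> to \<open>\<nu> + 1/2\<close>.\<close>
    then have "cmod (deriv h u) * (q * s powr (1/2)) \<le> sqrt \<bar>wirtinger_jacobian f u\<bar>"
      using s by (simp only: q_def real_sqrt_mult powr_half_sqrt real_sqrt_abs abs_norm_cancel)
    then have "s powr \<nu> * (cmod (deriv h u) * (q * s powr (1/2))) \<le> bloch_weight \<nu> f u"
      by (simp add: bloch_weight_def s_def mult_left_mono)
    also have "\<dots> \<le> bloch_beta \<nu> f"
      unfolding bloch_beta_def using u by (intro cSUP_upper bdd) auto
    finally have *: "cmod (deriv h u) * (q * s powr (\<nu> + 1/2)) \<le> bloch_beta \<nu> f"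
      by (simp add: powr_add mult_ac)
    \<comment> \<open>The supremum dominates a nonnegative quantity, which gives the sign of K for
      the last step of the chain below.\<close>
    have "0 \<le> cmod (deriv h u) * (q * s powr (\<nu> + 1/2))" using q by simp
    with * have K: "0 \<le> K" using c by (simp add: K_def)
    have "cmod (deriv h u) \<le> bloch_beta \<nu> f * (inverse q * inverse (s powr (\<nu> + 1/2)))"
      using * q s by (simp add: field_simps)
    also have "\<dots> = K * s powr (- \<nu> - 1/2)"
      using q(2) powr_minus[of s "\<nu> + 1/2"] by (simp add: K_def)
    \<comment> \<open>The exponent is negative, so passing from s to the smaller base 1 - |u|
      enlarges the power.\<close>
    also have "\<dots> \<le> K * (1 - cmod u) powr (- \<nu> - 1/2)"
      using K us u nu by (intro mult_left_mono powr_mono2') auto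
    finally show ?thesis .
  qed
  \<comment> \<open>Positivity of the Jacobian makes g' smaller than h' in modulus, so one estimate
    serves both parts.\<close>
  have "cmod (deriv g u) \<le> K * (1 - cmod u) powr (- \<nu> - 1/2)" if "cmod u < 1" for u
    using gh[OF that] h'[OF that] by simp
  then have "cmod (g z - g 0) \<le> K * h_nu \<nu> (cmod z)" "cmod (h z - h 0) \<le> K * h_nu \<nu> (cmod z)"
    using radial_growth_h_nu[OF g _ z] radial_growth_h_nu[OF h h' z] by blast+
  then show ?thesis using \<open>g 0 = 0\<close> by (simp add: K_def c_def \<omega>_def)
qed

text \<open>For \<open>\<nu> < 1/2\<close> the function \<open>h_nu\<close> stays bounded up to r =
  1, so the growth bound becomes uniform in z. Using |K| avoids a separate argument for the sign of
  K.\<close>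

lemma bounded_parts:
  assumes nu: "0 < \<nu>" "\<nu> < 1/2"
    and f: "f \<in> harmonic_bloch_type \<nu>" and dec: "canonical_decomposition f h g"
    and sp: "sense_preserving f"
  shows "bounded (h ` ball 0 1)" "bounded (g ` ball 0 1)" "bounded (f ` ball 0 1)"
proof -
  define K where "K = bloch_beta \<nu> f * sqrt ((1 + cmod (dilatation h g 0)) / (1 - cmod (dilatation h g 0)))"
  have le: "cmod (h z - h 0) \<le> \<bar>K\<bar> * inverse (1/2 - \<nu>)" "cmod (g z) \<le> \<bar>K\<bar> * inverse (1/2 - \<nu>)"
    if "cmod z < 1" for z
  proof -
    have "K * h_nu \<nu> (cmod z) \<le> \<bar>K\<bar> * h_nu \<nu> (cmod z)"
      using that by (intro mult_right_mono h_nu_nonneg) auto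
    also have "\<dots> \<le> \<bar>K\<bar> * inverse (1/2 - \<nu>)"
      by (intro mult_left_mono h_nu_le nu) auto
    finally show "cmod (h z - h 0) \<le> \<bar>K\<bar> * inverse (1/2 - \<nu>)" "cmod (g z) \<le> \<bar>K\<bar> * inverse (1/2 - \<nu>)"
      using growth_bound[OF nu(1) f dec sp that] by (simp_all add: K_def)
  qed
  have "cmod (h z) \<le> \<bar>K\<bar> * inverse (1/2 - \<nu>) + cmod (h 0)" if "cmod z < 1" for z
    using le(1)[OF that] norm_triangle_ineq2[of "h z" "h 0"] by linarith
  then show bh: "bounded (h ` ball 0 1)" by (force simp: bounded_iff)
  show bg: "bounded (g ` ball 0 1)" using le(2) by (force simp: bounded_iff)
  have "bounded ((\<lambda>z. h z + cnj (g z)) ` ball 0 1)"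
    using bh bg by (intro bounded_plus_comp) (auto simp: bounded_iff)
  moreover have "f ` ball 0 1 = (\<lambda>z. h z + cnj (g z)) ` ball 0 1"
    using dec by (intro image_cong) (auto simp: canonical_decomposition_def)
  ultimately show "bounded (f ` ball 0 1)" by simp
qed

section \<open>Sharpness of the order of growth\<close>

lemma sharpness_example:
  fixes \<nu> :: real
  assumes nu: "\<nu> > 1/2"
  shows "\<exists>f h g. f \<in> harmonic_bloch_type \<nu> \<and> canonical_decomposition f h g \<and> sense_preserving f \<and>
           (\<lambda>r. SUP z\<in>sphere 0 r. max (cmod (h z - h 0)) (cmod (g z)))
             \<in> \<Theta>[at_left 1](\<lambda>r. bloch_beta \<nu> f
                 * sqrt ((1 + cmod (dilatation h g 0)) / (1 - cmod (dilatation h g 0)))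
                 * h_nu \<nu> r)"
proof -
  define h :: "complex \<Rightarrow> complex" where "h = h_nu \<nu>"
  \<comment> \<open>Lowering the parameter by 1 multiplies the derivative of \<open>h_nu\<close> by
    1 - z, so the difference has derivative z h'. Hence the dilatation is z.\<close>
  define g :: "complex \<Rightarrow> complex" where "g = (\<lambda>z. h_nu \<nu> z - h_nu (\<nu> - 1) z)"
  define f where "f = (\<lambda>z. h z + cnj (g z))"
  define p where "p = \<nu> + 1/2"
  have h': "(h has_field_derivative (1 - z) powr of_real (- p)) (at z)"
    and g': "(g has_field_derivative z * (1 - z) powr of_real (- p)) (at z)" if z: "cmod z < 1" for z
  proof -
    show "(h has_field_derivative (1 - z) powr of_real (- p)) (at z)"
      using has_field_derivative_h_nu[OF z, of \<nu>] by (simp add: h_def p_def)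
    have "1 - z \<noteq> 0" using z by auto
    then have "(1 - z) powr (of_real (- p) + 1) = (1 - z) powr of_real (- p) * (1 - z)"
      by (subst powr_add) simp
    moreover have "of_real (- (\<nu> - 1) - 1/2) = complex_of_real (- p) + 1" by (simp add: p_def)
    ultimately have "(h_nu (\<nu> - 1) has_field_derivative (1 - z) powr of_real (- p) * (1 - z)) (at z)"
      using has_field_derivative_h_nu[OF z, of "\<nu> - 1"] by metis
    from DERIV_diff[OF has_field_derivative_h_nu[OF z, of \<nu>] this]
    show "(g has_field_derivative z * (1 - z) powr of_real (- p)) (at z)"
      by (simp add: g_def p_def algebra_simps)
  qed
  have hol: "h holomorphic_on ball 0 1" "g holomorphic_on ball 0 1"
    using h' g' by (auto simp: holomorphic_on_open intro!: exI)
  have dec: "canonical_decomposition f h g"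
    using hol by (simp add: canonical_decomposition_def f_def g_def analytic_on_open)
  have harm: "harmonic_mapping f"
    by (rule harmonic_mapping_holomorphic_plus_cnj[OF hol]) (simp add: f_def)
  have J: "wirtinger_jacobian f z = (1 - (cmod z)\<^sup>2) * (cmod (1 - z) powr (- p))\<^sup>2" if z: "cmod z < 1" for z
  proof -
    have "wirtinger_z f z = deriv h z" "wirtinger_zbar f z = cnj (deriv g z)"
      using wirtinger_holomorphic_plus_cnj[OF open_ball hol, of f z] z by (simp_all add: f_def)
    moreover have "cmod ((1 - z) powr of_real (- p)) = cmod (1 - z) powr (- p)"
      by (simp add: norm_powr_real_powr')
    ultimately show ?thesis
      using DERIV_imp_deriv[OF h'[OF z]] DERIV_imp_deriv[OF g'[OF z]]
      by (simp add: wirtinger_jacobian_def norm_mult power_mult_distrib algebra_simps)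
  qed
  have sp: "sense_preserving f"
    unfolding sense_preserving_def
  proof
    fix z :: complex assume "z \<in> ball 0 1"
    then show "0 < wirtinger_jacobian f z"
      by (auto simp: J abs_square_less_1 intro!: mult_pos_pos)
  qed
  have weight: "bloch_weight \<nu> f z \<le> 2 powr p" if z: "cmod z < 1" for z
  proof -
    define s where "s = 1 - (cmod z)\<^sup>2"
    have s: "0 < s" using z by (simp add: s_def abs_square_less_1)
    have d: "0 < cmod (1 - z)" "1 - cmod z \<le> cmod (1 - z)"
      using z norm_triangle_ineq2[of 1 z] by auto
    \<comment> \<open>Since 1 - |z| is at most |1 - z|, the quotient s / |1 - z| is at most 2; the
      weighted root of the Jacobian is its p-th power.\<close>
    have "s = (1 + cmod z) * (1 - cmod z)" by (simp add: s_def power2_eq_square algebra_simps)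
    also have "\<dots> \<le> 2 * cmod (1 - z)" using z d by (intro mult_mono) auto
    finally have sd: "s / cmod (1 - z) \<le> 2" using d by (simp add: field_simps)
    have "sqrt \<bar>wirtinger_jacobian f z\<bar> = s powr (1/2) * cmod (1 - z) powr (- p)"
      using s by (simp add: J[OF z] real_sqrt_mult powr_half_sqrt flip: s_def)
    then have "bloch_weight \<nu> f z = s powr p * cmod (1 - z) powr (- p)"
      by (simp add: bloch_weight_def p_def powr_add flip: s_def)
    also have "\<dots> = (s / cmod (1 - z)) powr p"
      using s d by (simp add: powr_divide powr_minus_divide)
    also have "\<dots> \<le> 2 powr p" using sd s d nu by (intro powr_mono2) (auto simp: p_def)
    finally show ?thesis .
  qed
  then have bdd: "bdd_above (bloch_weight \<nu> f ` ball 0 1)" by (auto intro!: bdd_aboveI2)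
  then have f: "f \<in> harmonic_bloch_type \<nu>" using harm by (simp add: harmonic_bloch_type_def)
  \<comment> \<open>At the origin the Jacobian and the weight are both 1, which keeps the Bloch
    constant, and with it K, away from 0.\<close>
  have "bloch_weight \<nu> f 0 \<le> bloch_beta \<nu> f"
    unfolding bloch_beta_def by (intro cSUP_upper bdd) auto
  then have \<beta>: "1 \<le> bloch_beta \<nu> f" by (simp add: bloch_weight_def J)
  define K where "K = bloch_beta \<nu> f * sqrt ((1 + cmod (dilatation h g 0)) / (1 - cmod (dilatation h g 0)))"
  have "dilatation h g 0 = 0"
    using DERIV_imp_deriv[OF g'[of 0]] by (simp add: dilatation_def)
  then have K: "1 \<le> K" using \<beta> by (simp add: K_def)
  define M where "M = (\<lambda>r. SUP z\<in>sphere 0 r. max (cmod (h z - h 0)) (cmod (g z)))"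
  have M: "h_nu \<nu> r \<le> M r" "M r \<le> K * h_nu \<nu> r" if r: "0 < r" "r < 1" for r
  proof -
    have le: "max (cmod (h z - h 0)) (cmod (g z)) \<le> K * h_nu \<nu> r" if "z \<in> sphere 0 r" for z
      using growth_bound[OF _ f dec sp, of z] that r nu by (simp add: K_def)
    have r_in: "complex_of_real r \<in> sphere 0 r" using r by simp
    show "M r \<le> K * h_nu \<nu> r"
      unfolding M_def using r_in le by (intro cSUP_least) auto
    \<comment> \<open>The positive radius is the extremal direction: there h takes the real value
      \<open>h_nu \<nu> r\<close>.\<close>
    have "h_nu \<nu> r = cmod (h (of_real r) - h 0)"
      using r h_nu_nonneg[of r \<nu>] by (simp add: h_def h_nu_of_real)
    also have "\<dots> \<le> max (cmod (h (of_real r) - h 0)) (cmod (g (of_real r)))" by simp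
    also have "\<dots> \<le> M r"
      unfolding M_def by (intro cSUP_upper r_in bdd_aboveI2[OF le])
    finally show "h_nu \<nu> r \<le> M r" .
  qed
  have ev: "\<forall>\<^sub>F r in at_left 1. 0 < r \<and> r < (1::real)"
    using eventually_at_left_real[of 0 1] by simp
  have "M \<in> \<Theta>[at_left 1](\<lambda>r. K * h_nu \<nu> r)"
  \<comment> \<open>The lower constant 1/K undoes the factor K of the comparison function; the upper
    constant is 1 by the growth bound itself.\<close>
  proof (rule bigthetaI'[of "1 / K" 1])
    show "\<forall>\<^sub>F r in at_left 1. 1 / K * norm (K * h_nu \<nu> r) \<le> norm (M r) \<and>
        norm (M r) \<le> 1 * norm (K * h_nu \<nu> r)"
      using ev
    proof eventually_elim
      case (elim r)
      then have "0 \<le> h_nu \<nu> r" "h_nu \<nu> r \<le> M r" "M r \<le> K * h_nu \<nu> r"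
        using M h_nu_nonneg by auto
      then show ?case using K by (simp add: abs_mult)
    qed
  qed (use K in auto)
  then show ?thesis using f dec sp unfolding M_def K_def by blast
qed

theorem theorem4:
  fixes \<nu> :: real
  assumes "\<nu> > 0"
  shows
    "(\<forall>(f :: complex \<Rightarrow> complex) (h :: complex \<Rightarrow> complex) (g :: complex \<Rightarrow> complex)
        (a :: nat \<Rightarrow> complex) (b :: nat \<Rightarrow> complex).
        f \<in> harmonic_bloch_type \<nu> \<longrightarrow>
        canonical_decomposition f h g \<longrightarrow>
        sense_preserving f \<longrightarrow>
        (\<forall>z\<in>ball 0 1. (\<lambda>n. a n * z ^ n) sums h z) \<longrightarrow>
        (\<forall>z\<in>ball 0 1. (\<lambda>n. b (Suc n) * z ^ Suc n) sums g z) \<longrightarrow>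
        (\<forall>z\<in>ball 0 1.
           max (cmod (h z - a 0)) (cmod (g z))
             \<le> bloch_beta \<nu> f
                 * sqrt ((1 + cmod (dilatation h g 0)) / (1 - cmod (dilatation h g 0)))
                 * h_nu \<nu> (cmod z)) \<and>
        (\<nu> < 1/2 \<longrightarrow>
           bounded (h ` ball 0 1) \<and> bounded (g ` ball 0 1) \<and> bounded (f ` ball 0 1)))
     \<and> (\<nu> > 1/2 \<longrightarrow>
        (\<exists>(f :: complex \<Rightarrow> complex) (h :: complex \<Rightarrow> complex) (g :: complex \<Rightarrow> complex).
           f \<in> harmonic_bloch_type \<nu> \<and>
           canonical_decomposition f h g \<and>
           sense_preserving f \<and>
           (\<lambda>r. SUP z\<in>sphere 0 r. max (cmod (h z - h 0)) (cmod (g z)))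
             \<in> \<Theta>[at_left 1](\<lambda>r. bloch_beta \<nu> f
                 * sqrt ((1 + cmod (dilatation h g 0)) / (1 - cmod (dilatation h g 0)))
                 * h_nu \<nu> r)))"
proof (intro conjI allI impI ballI)
  fix f h g :: "complex \<Rightarrow> complex" and a b :: "nat \<Rightarrow> complex" and z :: complex
  assume *: "f \<in> harmonic_bloch_type \<nu>" "canonical_decomposition f h g" "sense_preserving f"
    and h: "\<forall>z\<in>ball 0 1. (\<lambda>n. a n * z ^ n) sums h z" and z: "z \<in> ball 0 1"
  \<comment> \<open>At z = 0 the power series reduces to its constant term.\<close>
  have "a 0 = h 0" by (rule sums_unique2[OF powser_sums_zero bspec[OF h]]) simp
  then show "max (cmod (h z - a 0)) (cmod (g z))
             \<le> bloch_beta \<nu> f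
                 * sqrt ((1 + cmod (dilatation h g 0)) / (1 - cmod (dilatation h g 0)))
                 * h_nu \<nu> (cmod z)"
    using growth_bound[OF assms *, of z] z by simp
next
  fix f h g :: "complex \<Rightarrow> complex"
  assume "\<nu> < 1/2" "f \<in> harmonic_bloch_type \<nu>" "canonical_decomposition f h g" "sense_preserving f"
  note bounded_parts[OF assms this]
  then show "bounded (h ` ball 0 1)" "bounded (g ` ball 0 1)" "bounded (f ` ball 0 1)" .
qed (rule sharpness_example)

end
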